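(* Let $F$ be a field of characteristic not $2$, let $B$ and $B'$ be central simple division algebras over $F$, let $\sigma\in\mathrm{Aut}_F(B)$ and $\phi\in\mathrm{Aut}_F(B')$ be non-trivial automorphisms, and let $c\in B^{\times}$, $d\in B'^{\times}$. Put $D=D_r(B,\sigma,c)$ and $D'=D_r(B',\phi,d)$. Then a map $G:D\to D'$ is an isomorphism of $F$-algebras if and only if $G$ has the form $$G(x,y)=(\tau(x),\tau(y)b)\qquad(x,y\in B)$$ for some $F$-isomorphism $\tau:B\to B'$ and some $b\in F^{\times}$ such that $\phi\circ\tau=\tau\circ\sigma$ and $\tau(c)=db^2$.
   Context: For a central simple algebra $B$ over $F$, $\sigma\in\mathrm{Aut}_F(B)$ and $c\in B^{\times}$, $D_r(B,\sigma,c)$ denotes the $F$-vector space $B\oplus B$ with multiplication $(u,v)(x,y)=(ux+\sigma(vy)c,\,uy+vx)$ for $u,v,x,y\in B$; it is a unital nonassociative $F$-algebra. *)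

theory Defs
  imports "HOL-Analysis.Analysis"
begin

text \<open>An algebra over a field, not assumed associative or unital.  The multiplication is a
  parameter, so the same notion applies to an associative ring type (with \<^term>\<open>(*)\<close>) and to the
  nonassociative multiplications on a product type.\<close>

locale nonassoc_algebra = vector_space smul
  for smul :: "'f::field \<Rightarrow> 'a::ab_group_add \<Rightarrow> 'a" +
  fixes mul :: "'a \<Rightarrow> 'a \<Rightarrow> 'a"
  assumes mult_add_left: "mul (x + y) z = mul x z + mul y z"
    and mult_add_right: "mul x (y + z) = mul x y + mul x z"
    and mult_scale_left: "mul (smul a x) y = smul a (mul x y)"
    and mult_scale_right: "mul x (smul a y) = smul a (mul x y)"

locale algebra_iso =
  A: nonassoc_algebra scaleA multA + B: nonassoc_algebra scaleB multB +
  Vector_Spaces.linear scaleA scaleB f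
  for scaleA :: "'f::field \<Rightarrow> 'a::ab_group_add \<Rightarrow> 'a" and multA :: "'a \<Rightarrow> 'a \<Rightarrow> 'a"
    and scaleB :: "'f \<Rightarrow> 'b::ab_group_add \<Rightarrow> 'b" and multB :: "'b \<Rightarrow> 'b \<Rightarrow> 'b"
    and f :: "'a \<Rightarrow> 'b" +
  assumes map_mult: "f (multA x y) = multB (f x) (f y)"
    and bij_map: "bij f"

definition algebra_auts ::
    "('f::field \<Rightarrow> 'a::ab_group_add \<Rightarrow> 'a) \<Rightarrow> ('a \<Rightarrow> 'a \<Rightarrow> 'a) \<Rightarrow> ('a \<Rightarrow> 'a) set" where
  "algebra_auts smul mul = {f. algebra_iso smul mul smul mul f}"

text \<open>Closure under negation follows from closure under multiplication by \<^term>\<open>-1\<close>.\<close>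

definition two_sided_ideal :: "'a::ring_1 set \<Rightarrow> bool" where
  "two_sided_ideal I \<longleftrightarrow> 0 \<in> I \<and> (\<forall>x\<in>I. \<forall>y\<in>I. x + y \<in> I) \<and>
     (\<forall>x\<in>I. \<forall>r. r * x \<in> I \<and> x * r \<in> I)"

text \<open>Central simple algebras are finite-dimensional, by the usual convention.  Associativity,
  the unit and \<open>1 \<noteq> 0\<close> come from the class \<^class>\<open>ring_1\<close>; a central simple division algebra
  is one whose carrier type is of class \<^class>\<open>division_ring\<close>.\<close>

locale central_simple_algebra = nonassoc_algebra smul "(*)"
  for smul :: "'f::field \<Rightarrow> 'a::ring_1 \<Rightarrow> 'a" +
  assumes finite_dimensional: "\<exists>Basis. finite_dimensional_vector_space smul Basis"
    and central: "{z. \<forall>x. z * x = x * z} = range (\<lambda>a. smul a 1)"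
    and simple: "two_sided_ideal (I :: 'a set) \<Longrightarrow> I = {0} \<or> I = UNIV"

text \<open>The algebra \<open>D\<^sub>r(B, \<sigma>, c)\<close> lives on \<^typ>\<open>'a \<times> 'a\<close>, with componentwise addition
  and scalar multiplication.\<close>

abbreviation Dr_smul :: "('f::field \<Rightarrow> 'a::ring_1 \<Rightarrow> 'a) \<Rightarrow> 'f \<Rightarrow> 'a \<times> 'a \<Rightarrow> 'a \<times> 'a" where
  "Dr_smul smul \<equiv> module_prod.scale smul smul"

fun Dr_mult :: "('a::ring_1 \<Rightarrow> 'a) \<Rightarrow> 'a \<Rightarrow> 'a \<times> 'a \<Rightarrow> 'a \<times> 'a \<Rightarrow> 'a \<times> 'a" where
  "Dr_mult \<sigma> c (u, v) (x, y) = (u * x + \<sigma> (v * y) * c, u * y + v * x)"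

lemma Dr_nonassoc_algebra:
  assumes "\<sigma> \<in> algebra_auts smul (*)"
  shows "nonassoc_algebra (Dr_smul smul) (Dr_mult \<sigma> c)"
proof -
  interpret s: algebra_iso smul "(*)" smul "(*)" \<sigma>
    using assms by (simp add: algebra_auts_def)
  interpret P: vector_space_prod smul smul
    by unfold_locales
  have s_scale: "\<sigma> (smul a x) = smul a (\<sigma> x)" for a x
    by (rule s.scale)
  show ?thesis
  proof unfold_locales
    fix x y z :: "'a \<times> 'a" and a
    show "Dr_mult \<sigma> c (x + y) z = Dr_mult \<sigma> c x z + Dr_mult \<sigma> c y z"
      by (cases x; cases y; cases z) (simp add: algebra_simps s.add)
    show "Dr_mult \<sigma> c x (y + z) = Dr_mult \<sigma> c x y + Dr_mult \<sigma> c x z"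
      by (cases x; cases y; cases z) (simp add: algebra_simps s.add)
    show "Dr_mult \<sigma> c (Dr_smul smul a x) y = Dr_smul smul a (Dr_mult \<sigma> c x y)"
      by (cases x; cases y)
        (simp add: P.scale_prod s.A.mult_scale_left s_scale s.A.scale_right_distrib)
    show "Dr_mult \<sigma> c x (Dr_smul smul a y) = Dr_smul smul a (Dr_mult \<sigma> c x y)"
      by (cases x; cases y)
        (simp add: P.scale_prod s.A.mult_scale_left s.A.mult_scale_right s_scale
          s.A.scale_right_distrib)
  qed
qed

lemma Dr_unital:
  assumes "\<sigma> \<in> algebra_auts smul (*)"
  shows "Dr_mult \<sigma> c (1, 0) p = p" and "Dr_mult \<sigma> c p (1, 0) = p"
proof -
  interpret s: algebra_iso smul "(*)" smul "(*)" \<sigma>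
    using assms by (simp add: algebra_auts_def)
  have "\<sigma> 0 = 0"
    by (rule s.zero)
  then show "Dr_mult \<sigma> c (1, 0) p = p" and "Dr_mult \<sigma> c p (1, 0) = p"
    by (cases p; simp)+
qed

end

theory Submission
  imports Defs
begin

text \<open>Because \<open>\<sigma>\<close> is non-trivial, the middle nucleus of \<open>D\<^sub>r(B, \<sigma>, c)\<close> is \<open>B \<oplus> 0\<close>, so an isomorphism
  \<open>G\<close> restricts to an isomorphism \<open>\<tau>: B \<rightarrow> B'\<close>.  Put \<open>G(0, 1) = (a, b)\<close>.  As \<open>(0, 1)\<close> commutes with
  \<open>B \<oplus> 0\<close>, both \<open>a\<close> and \<open>b\<close> are central.  The product \<open>(0, 1)(0, 1)\<close> lies in \<open>B \<oplus> 0\<close>, which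
  forces \<open>2ab = 0\<close>, hence \<open>a = 0\<close>; the first component of \<open>(0, z)(0, 1)\<close> then gives the
  conditions on \<open>\<tau>\<close> and \<open>b\<close>.\<close>

definition middle_nucleus :: "('a \<Rightarrow> 'a \<Rightarrow> 'a) \<Rightarrow> 'a set" where
  "middle_nucleus mul = {q. \<forall>p r. mul (mul p q) r = mul p (mul q r)}"

text \<open>The middle nucleus is defined by the multiplication alone, and bijectivity of
  \<open>f\<close> lets both quantifiers over the target be replaced by quantifiers over
  images.\<close>

lemma middle_nucleus_iso:
  assumes hom: "\<And>x y. f (mul x y) = mul' (f x) (f y)" and "bij f"
  shows "f q \<in> middle_nucleus mul' \<longleftrightarrow> q \<in> middle_nucleus mul"
proof -
  have inj: "f x = f y \<longleftrightarrow> x = y" for x y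
    using \<open>bij f\<close> by (simp add: bij_is_inj inj_eq)
  have all: "(\<forall>p. P p) \<longleftrightarrow> (\<forall>p. P (f p))" for P
    using \<open>bij f\<close> by (metis bij_pointE)
  have "f q \<in> middle_nucleus mul' \<longleftrightarrow>
      (\<forall>p r. mul' (mul' (f p) (f q)) (f r) = mul' (f p) (mul' (f q) (f r)))"
    unfolding middle_nucleus_def
    by (subst mem_Collect_eq, subst all, intro iff_allI, subst all, rule refl)
  also have "\<dots> \<longleftrightarrow> q \<in> middle_nucleus mul"
    by (simp add: middle_nucleus_def hom[symmetric] inj)
  finally show ?thesis .
qed

text \<open>Associating \<open>(u, 0)\<close>, \<open>(x, y)\<close>, \<open>(0, 1)\<close> and
  comparing first components gives \<sigma>(u) \<sigma>(y) c = u \<sigma>(y) c. If y were nonzero,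
  cancelling \<sigma>(y) c would make \<sigma> the identity.\<close>

lemma middle_nucleus_Dr:
  fixes \<sigma> :: "'b::division_ring \<Rightarrow> 'b"
  assumes add: "\<And>x y. \<sigma> (x + y) = \<sigma> x + \<sigma> y" and mult: "\<And>x y. \<sigma> (x * y) = \<sigma> x * \<sigma> y"
    and "bij \<sigma>" "\<sigma> \<noteq> id" "c \<noteq> 0"
  shows "middle_nucleus (Dr_mult \<sigma> c) = UNIV \<times> {0}"
proof -
  have zero: "\<sigma> 0 = 0"
    using add[of 0 0] by simp
  have "y = 0" if "(x, y) \<in> middle_nucleus (Dr_mult \<sigma> c)" for x y
  proof (rule ccontr)
    assume "y \<noteq> 0"
    then have y: "\<sigma> y \<noteq> 0"
      using \<open>bij \<sigma>\<close> zero by (metis bij_pointE)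
    have "\<sigma> u = u" for u
    proof -
      have "Dr_mult \<sigma> c (Dr_mult \<sigma> c (u, 0) (x, y)) (0, 1)
          = Dr_mult \<sigma> c (u, 0) (Dr_mult \<sigma> c (x, y) (0, 1))"
        using that unfolding middle_nucleus_def by blast
      then have "\<sigma> u * \<sigma> y * c = u * \<sigma> y * c"
        by (simp add: zero mult mult.assoc)
      with y \<open>c \<noteq> 0\<close> show ?thesis by simp
    qed
    with \<open>\<sigma> \<noteq> id\<close> show False by auto
  qed
  \<comment> \<open>Multiplication by \<open>(x, 0)\<close> from either side acts componentwise, so
    associativity of B suffices.\<close>
  moreover have "(x, 0) \<in> middle_nucleus (Dr_mult \<sigma> c)" for x
    by (auto simp: middle_nucleus_def zero algebra_simps)
  ultimately show ?thesis by auto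
qed

lemma Dr_smul_Pair:
  assumes "vector_space smul"
  shows "Dr_smul smul a (x, y) = (smul a x, smul a y)"
proof -
  interpret vector_space smul by fact
  interpret P: vector_space_prod smul smul by unfold_locales
  show ?thesis by (simp add: P.scale_prod)
qed

lemma algebra_isoI:
  assumes "nonassoc_algebra s m" "nonassoc_algebra s' m'"
    and "\<And>x y. f (x + y) = f x + f y" "\<And>a x. f (s a x) = s' a (f x)"
    and "\<And>x y. f (m x y) = m' (f x) (f y)" "bij f"
  shows "algebra_iso s m s' m' f"
proof -
  interpret A: nonassoc_algebra s m by fact
  interpret B: nonassoc_algebra s' m' by fact
  show ?thesis
    by unfold_locales (use assms in auto)
qed

lemma algebra_isoD:
  assumes "algebra_iso s m s' m' f"
  shows "f (x + y) = f x + f y" "f (s a x) = s' a (f x)" "f (m x y) = m' (f x) (f y)" "bij f"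
    and "nonassoc_algebra s m" "nonassoc_algebra s' m'"
proof -
  interpret algebra_iso s m s' m' f by fact
  show "f (x + y) = f x + f y" "f (s a x) = s' a (f x)" "f (m x y) = m' (f x) (f y)" "bij f"
    by (simp_all add: add scale map_mult bij_map)
  show "nonassoc_algebra s m" "nonassoc_algebra s' m'"
    by unfold_locales
qed

text \<open>The sum x + x is the scalar multiple 2x. If 2 were zero in the field, the characteristic
  would divide 2, hence be 1 or 2; both are excluded.\<close>

lemma (in vector_space) double_eq_zero:
  fixes x :: 'b
  assumes "CHAR('a) \<noteq> 2" "x + x = 0"
  shows "x = 0"
proof -
  have "(2::'a) \<noteq> 0"
  proof
    assume "(2::'a) = 0"
    then have "of_nat 2 = (0::'a)" by simp
    then have "CHAR('a) dvd 2"
      by (simp only: of_nat_eq_0_iff_char_dvd)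
    then have "CHAR('a) \<in> {1, 2}"
      using dvd_imp_le[of "CHAR('a)" 2] by (cases "CHAR('a)") auto
    with assms(1) CHAR_not_1' show False by auto
  qed
  moreover have "scale 2 x = 0"
    using assms(2) scale_left_distrib[of 1 1 x] by simp
  ultimately show ?thesis by simp
qed

text \<open>Multiplicativity rests on the first component: the scalar b passes through \<phi>, so
  \<phi>(\<tau>(v) b \<tau>(y) b) d = \<tau>(\<sigma>(v y)) d b b, which is \<tau>(\<sigma>(v y) c)
  by the condition on \<tau>(c).\<close>

lemma Dr_isoI:
  fixes scaleB :: "'f::field \<Rightarrow> 'b::division_ring \<Rightarrow> 'b"
    and scaleB' :: "'f \<Rightarrow> 'c::division_ring \<Rightarrow> 'c"
  assumes \<sigma>: "\<sigma> \<in> algebra_auts scaleB (*)" and \<phi>: "\<phi> \<in> algebra_auts scaleB' (*)"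
    and \<tau>: "algebra_iso scaleB (*) scaleB' (*) \<tau>" and "b \<noteq> 0"
    and comm: "\<And>x. \<phi> (\<tau> x) = \<tau> (\<sigma> x)" and c: "\<tau> c = d * (scaleB' b 1)\<^sup>2"
  shows "algebra_iso (Dr_smul scaleB) (Dr_mult \<sigma> c) (Dr_smul scaleB') (Dr_mult \<phi> d)
    (\<lambda>(x, y). (\<tau> x, \<tau> y * scaleB' b 1))"
proof (rule algebra_isoI)
  note tau = algebra_isoD[OF \<tau>]
    and phi = algebra_isoD[OF \<phi>[unfolded algebra_auts_def mem_Collect_eq]]
  interpret S: nonassoc_algebra scaleB "(*)" by (rule tau)
  interpret S': nonassoc_algebra scaleB' "(*)" by (rule tau)
  have pair: "Dr_smul scaleB a (x, y) = (scaleB a x, scaleB a y)" for a x y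
    by (rule Dr_smul_Pair) unfold_locales
  have pair': "Dr_smul scaleB' a (x, y) = (scaleB' a x, scaleB' a y)" for a x y
    by (rule Dr_smul_Pair) unfold_locales
  note scale = S'.mult_scale_left S'.mult_scale_right
  show "nonassoc_algebra (Dr_smul scaleB) (Dr_mult \<sigma> c)"
    using \<sigma> by (rule Dr_nonassoc_algebra)
  show "nonassoc_algebra (Dr_smul scaleB') (Dr_mult \<phi> d)"
    using \<phi> by (rule Dr_nonassoc_algebra)
  show "(case p + q of (x, y) \<Rightarrow> (\<tau> x, \<tau> y * scaleB' b 1)) =
      (case p of (x, y) \<Rightarrow> (\<tau> x, \<tau> y * scaleB' b 1)) +
      (case q of (x, y) \<Rightarrow> (\<tau> x, \<tau> y * scaleB' b 1))" for p q
    by (cases p; cases q) (simp add: tau algebra_simps)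
  show "(case Dr_smul scaleB a p of (x, y) \<Rightarrow> (\<tau> x, \<tau> y * scaleB' b 1)) =
      Dr_smul scaleB' a (case p of (x, y) \<Rightarrow> (\<tau> x, \<tau> y * scaleB' b 1))" for a p
    by (cases p) (simp add: pair pair' tau scale)
  show "(case Dr_mult \<sigma> c p q of (x, y) \<Rightarrow> (\<tau> x, \<tau> y * scaleB' b 1)) =
      Dr_mult \<phi> d (case p of (x, y) \<Rightarrow> (\<tau> x, \<tau> y * scaleB' b 1))
        (case q of (x, y) \<Rightarrow> (\<tau> x, \<tau> y * scaleB' b 1))" for p q
    by (cases p; cases q)
      (simp add: tau phi c comm[symmetric] scale power2_eq_square algebra_simps
        S'.scale_right_distrib)
  \<comment> \<open>Bijectivity is shown by an explicit inverse, which divides the second component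
    by b and then applies \<open>inv \<tau>\<close> to both components.\<close>
  have inverse: "scaleB' b (scaleB' (inverse b) x) = x" "scaleB' (inverse b) (scaleB' b x) = x"
    for x using \<open>b \<noteq> 0\<close> by simp_all
  have inv: "\<tau> (inv \<tau> x) = x" "inv \<tau> (\<tau> y) = y" for x y
    using tau(4) by (simp_all add: bij_is_inj bij_is_surj surj_f_inv_f)
  show "bij (\<lambda>(x, y). (\<tau> x, \<tau> y * scaleB' b 1))"
    by (rule o_bij[where g = "\<lambda>(x, y). (inv \<tau> x, inv \<tau> (scaleB' (inverse b) y))"])
      (auto simp: fun_eq_iff inv inverse scale simp del: S'.scale_scale)
qed

text \<open>Since (x, y) = (x, 0) + (y, 0)(0, 1), the map G is determined by its restriction to B
  \<oplus> 0 and by the image of \<open>(0, 1)\<close>.\<close>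

lemma Dr_isoE:
  fixes scaleB :: "'f::field \<Rightarrow> 'b::division_ring \<Rightarrow> 'b"
    and scaleB' :: "'f \<Rightarrow> 'c::division_ring \<Rightarrow> 'c"
  assumes char: "CHAR('f) \<noteq> 2"
    and central: "{z. \<forall>x. z * x = x * z} = range (\<lambda>a. scaleB' a 1)"
    and \<sigma>: "\<sigma> \<in> algebra_auts scaleB (*)" "\<sigma> \<noteq> id"
    and \<phi>: "\<phi> \<in> algebra_auts scaleB' (*)" "\<phi> \<noteq> id"
    and c: "c \<noteq> 0" and d: "d \<noteq> 0"
    and G: "algebra_iso (Dr_smul scaleB) (Dr_mult \<sigma> c) (Dr_smul scaleB') (Dr_mult \<phi> d) G"
  obtains \<tau> b where "algebra_iso scaleB (*) scaleB' (*) \<tau>" "b \<noteq> 0" "\<phi> \<circ> \<tau> = \<tau> \<circ> \<sigma>"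
    "\<tau> c = d * (scaleB' b 1)\<^sup>2" "\<And>x y. G (x, y) = (\<tau> x, \<tau> y * scaleB' b 1)"
proof -
  note sig = algebra_isoD[OF \<sigma>(1)[unfolded algebra_auts_def mem_Collect_eq]]
    and phi = algebra_isoD[OF \<phi>(1)[unfolded algebra_auts_def mem_Collect_eq]]
    and iso = algebra_isoD[OF G]
  interpret S: nonassoc_algebra scaleB "(*)" by (rule sig)
  interpret S': nonassoc_algebra scaleB' "(*)" by (rule phi)
  have pair: "Dr_smul scaleB a (x, y) = (scaleB a x, scaleB a y)" for a x y
    by (rule Dr_smul_Pair) unfold_locales
  have pair': "Dr_smul scaleB' a (x, y) = (scaleB' a x, scaleB' a y)" for a x y
    by (rule Dr_smul_Pair) unfold_locales
  note scale = S'.mult_scale_left S'.mult_scale_right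
  have sig0: "\<sigma> 0 = 0" using sig(1)[of 0 0] by simp
  have phi0: "\<phi> 0 = 0" using phi(1)[of 0 0] by simp
  \<comment> \<open>On both sides a vanishing second component means membership in the middle
    nucleus, which G preserves and reflects.\<close>
  have G_snd: "snd (G p) = 0 \<longleftrightarrow> snd p = 0" for p
    using middle_nucleus_iso[of G "Dr_mult \<sigma> c" "Dr_mult \<phi> d" p, OF iso(3,4)]
      middle_nucleus_Dr[OF sig(1,3,4) \<sigma>(2) c] middle_nucleus_Dr[OF phi(1,3,4) \<phi>(2) d]
    by (simp add: mem_Times_iff)
  define \<tau> where "\<tau> x = fst (G (x, 0))" for x
  have G_left: "G (x, 0) = (\<tau> x, 0)" for x
    using G_snd[of "(x, 0)"] by (simp add: \<tau>_def prod_eq_iff)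
  have tau_mult: "\<tau> (x * y) = \<tau> x * \<tau> y" for x y
    using iso(3)[of "(x, 0)" "(y, 0)"] by (simp add: G_left sig0 phi0)
  have tau_bij: "bij \<tau>"
  proof (rule bijI)
    show "inj \<tau>"
      using iso(4) G_left by (metis bij_is_inj injD injI prod.inject)
    show "surj \<tau>"
    proof (rule surjI)
      fix z
      \<comment> \<open>Reflection of the nucleus puts the preimage of \<open>(z, 0)\<close> into B
        \<oplus> 0, so its first component is a preimage of z under \<tau>.\<close>
      have "G (inv G (z, 0)) = (z, 0)"
        using iso(4) by (simp add: bij_is_surj surj_f_inv_f)
      moreover from this have "snd (inv G (z, 0)) = 0"
        using G_snd by (metis snd_conv)
      ultimately show "\<tau> (fst (inv G (z, 0))) = z"
        by (metis G_left fst_conv prod.collapse)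
    qed
  qed
  have tau: "algebra_iso scaleB (*) scaleB' (*) \<tau>"
  proof (rule algebra_isoI)
    show "\<tau> (x + y) = \<tau> x + \<tau> y" for x y
      using iso(1)[of "(x, 0)" "(y, 0)"] by (simp add: G_left)
    show "\<tau> (scaleB a x) = scaleB' a (\<tau> x)" for a x
      using iso(2)[of a "(x, 0)"] by (simp add: G_left pair pair')
  qed (use sig phi tau_mult tau_bij in auto)
  \<comment> \<open>Multiplicativity makes \<tau>(1) a left identity on the range of \<tau>, and
    this range contains 1.\<close>
  have tau1: "\<tau> 1 = 1"
    using tau_mult[of 1] tau_bij by (metis bij_pointE mult.right_neutral mult.left_neutral)
  obtain a e where ae: "G (0, 1) = (a, e)" by fastforce
  have G_right: "G (0, y) = (\<tau> y * a, \<tau> y * e)" for y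
    using iso(3)[of "(y, 0)" "(0, 1)"] by (simp add: G_left ae sig0 phi0)
  \<comment> \<open>The product (0, 1)(y, 0) is again (0, y), so its image must agree with
    \<open>G_right\<close>.\<close>
  have "\<tau> y * a = a * \<tau> y \<and> \<tau> y * e = e * \<tau> y" for y
    using iso(3)[of "(0, 1)" "(y, 0)"] by (simp add: G_left G_right ae sig0 phi0 tau1)
  then have "a * z = z * a" "e * z = z * e" for z
    using tau_bij by (metis bij_pointE)+
  \<comment> \<open>The centre of B' consists of the scalars, so e comes from some b in F.\<close>
  then have "e \<in> range (\<lambda>a. scaleB' a 1)"
    unfolding central[symmetric] by simp
  then obtain b where e: "e = scaleB' b 1" by auto
  have "e \<noteq> 0"
    using G_snd[of "(0, 1)"] ae by simp
  then have b: "b \<noteq> 0" using e by auto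
  \<comment> \<open>These are the two components of the image of (0, y)(0, 1) = (\<sigma>(y) c,
    0).\<close>
  have square: "\<tau> (\<sigma> y) * \<tau> c = \<tau> y * a * a + \<phi> (\<tau> y * e * e) * d" "\<tau> y * a * e + \<tau> y * e * a = 0" for y
    using iso(3)[of "(0, y)" "(0, 1)"] by (simp_all add: G_left G_right tau1 tau_mult mult.assoc ae)
  have "a * e + a * e = 0"
    using square(2)[of 1] \<open>e * a = a * e\<close> by (simp add: tau1)
  then have "a * e = 0" by (rule S'.double_eq_zero[OF char])
  then have a: "a = 0" using \<open>e \<noteq> 0\<close> by simp
  have phi1: "\<phi> 1 = 1"
    using phi(3)[of 1] phi(4) by (metis bij_pointE mult.right_neutral mult.left_neutral)
  have sig1: "\<sigma> 1 = 1"
    using sig(3)[of 1] sig(4) by (metis bij_pointE mult.right_neutral mult.left_neutral)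
  \<comment> \<open>As e is a scalar, linearity of \<phi> takes its square out of \<phi>, and it can
    then be moved past d.\<close>
  have eq: "\<tau> (\<sigma> y) * \<tau> c = \<phi> (\<tau> y) * (d * e\<^sup>2)" for y
    using square(1)[of y] by (simp add: a e scale phi power2_eq_square mult.assoc)
  have tauc: "\<tau> c = d * e\<^sup>2"
    using eq[of 1] by (simp add: tau1 sig1 phi1)
  \<comment> \<open>Substituting \<tau>(c), found at y = 1, leaves the nonzero right factor
    \<open>d * e\<^sup>2\<close> on both sides, and it cancels.\<close>
  have "\<phi> (\<tau> y) = \<tau> (\<sigma> y)" for y
    using eq[of y] d \<open>e \<noteq> 0\<close> by (simp add: tauc)
  moreover have "G (x, y) = (\<tau> x, \<tau> y * e)" for x y
    using iso(1)[of "(x, 0)" "(0, y)"] by (simp add: G_left G_right a)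
  ultimately show thesis
    using that tau b tauc by (auto simp: e fun_eq_iff)
qed

theorem theorem3p13:
  fixes scaleB :: "'f::field \<Rightarrow> 'b::division_ring \<Rightarrow> 'b"
    and scaleB' :: "'f \<Rightarrow> 'c::division_ring \<Rightarrow> 'c"
    and \<sigma> :: "'b \<Rightarrow> 'b" and \<phi> :: "'c \<Rightarrow> 'c"
    and c :: 'b and d :: 'c
    and G :: "'b \<times> 'b \<Rightarrow> 'c \<times> 'c"
  assumes char: "CHAR('f) \<noteq> 2"
    and B: "central_simple_algebra scaleB"
    and B': "central_simple_algebra scaleB'"
    and \<sigma>: "\<sigma> \<in> algebra_auts scaleB (*)" "\<sigma> \<noteq> id"
    and \<phi>: "\<phi> \<in> algebra_auts scaleB' (*)" "\<phi> \<noteq> id"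
    and c: "c \<noteq> 0" and d: "d \<noteq> 0"
  shows "algebra_iso (Dr_smul scaleB) (Dr_mult \<sigma> c) (Dr_smul scaleB') (Dr_mult \<phi> d) G \<longleftrightarrow>
    (\<exists>\<tau> b. algebra_iso scaleB (*) scaleB' (*) \<tau> \<and> b \<noteq> 0 \<and>
       \<phi> \<circ> \<tau> = \<tau> \<circ> \<sigma> \<and> \<tau> c = d * (scaleB' b 1)\<^sup>2 \<and>
       (\<forall>x y. G (x, y) = (\<tau> x, \<tau> y * scaleB' b 1)))"
proof
  assume "algebra_iso (Dr_smul scaleB) (Dr_mult \<sigma> c) (Dr_smul scaleB') (Dr_mult \<phi> d) G"
  from Dr_isoE[OF char central_simple_algebra.central[OF B'] \<sigma> \<phi> c d this]
  show "\<exists>\<tau> b. algebra_iso scaleB (*) scaleB' (*) \<tau> \<and> b \<noteq> 0 \<and>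
       \<phi> \<circ> \<tau> = \<tau> \<circ> \<sigma> \<and> \<tau> c = d * (scaleB' b 1)\<^sup>2 \<and>
       (\<forall>x y. G (x, y) = (\<tau> x, \<tau> y * scaleB' b 1))"
    by metis
next
  assume "\<exists>\<tau> b. algebra_iso scaleB (*) scaleB' (*) \<tau> \<and> b \<noteq> 0 \<and>
       \<phi> \<circ> \<tau> = \<tau> \<circ> \<sigma> \<and> \<tau> c = d * (scaleB' b 1)\<^sup>2 \<and>
       (\<forall>x y. G (x, y) = (\<tau> x, \<tau> y * scaleB' b 1))"
  then obtain \<tau> b where *: "algebra_iso scaleB (*) scaleB' (*) \<tau>" "b \<noteq> 0"
      "\<phi> \<circ> \<tau> = \<tau> \<circ> \<sigma>" "\<tau> c = d * (scaleB' b 1)\<^sup>2"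
    and "\<forall>x y. G (x, y) = (\<tau> x, \<tau> y * scaleB' b 1)"
    by blast
  then have G: "G = (\<lambda>(x, y). (\<tau> x, \<tau> y * scaleB' b 1))" by auto
  then show "algebra_iso (Dr_smul scaleB) (Dr_mult \<sigma> c) (Dr_smul scaleB') (Dr_mult \<phi> d) G"
    unfolding G using *(3) by (intro Dr_isoI \<sigma>(1) \<phi>(1) *) (simp add: fun_eq_iff)
qed

end
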